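(* Let $d,r \in \mathbb{N}$ and let $M \ge 2^r r!$ be a real number. Then $$ e^{\rm ran}(n, F^r_{M,d}) \ge \frac{1}{2}\sqrt{2} \qquad \text{for } n = 1,2,\dots,2^{d-1}. $$
   Context: $\mathbb{N}=\{1,2,\dots\}$. For $r\in\mathbb{N}$, $W^r_\infty[0,1]$ is the set of all (continuous) functions $g:[0,1]\to\mathbb{R}$ which have $r$ weak derivatives in $L_\infty$; $g^{(r)}$ denotes the $r$th weak derivative. For $d\in\mathbb{N}$ and $M>0$, $F^r_{M,d}$ is the set of all functions $f:[0,1]^d\to\mathbb{R}$ of the form $f(x_1,\dots,x_d)=\prod_{i=1}^d f_i(x_i)$ with $f_i\in W^r_\infty[0,1]$, $\|f_i\|_\infty\le 1$ and $\|f_i^{(r)}\|_\infty\le M$ for all $i=1,\dots,d$. A deterministic algorithm $A_n$ using at most $n$ function values is a map of the form $A_n(f)=\phi(f(x_1),\dots,f(x_n))$ with $\phi:\mathbb{R}^n\to L_\infty([0,1]^d)$, where the points $x_i\in[0,1]^d$ may be chosen adaptively, i.e. $x_i$ may depend on the already known values $f(x_1),\dots,f(x_{i-1})$. A randomized algorithm using at most $n$ function values is a random deterministic algorithm of this kind: the $x_i$ and $\phi$ may additionally depend on a random element $\omega$ of a probability space, so that $A_n(f)$ is a random variable (with the usual convention that the error $\|f-A_n(f)\|_\infty$ is measurable in $\omega$ for each input $f$). Its worst case error on a class $F_d$ is $$ e^{\rm ran}(A_n,F_d)=\sup_{f\in F_d}\left(\mathbb{E}\,\|f-A_n(f)\|_\infty^2\right)^{1/2},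 $$ and $e^{\rm ran}(n,F_d)=\inf_{A_n}e^{\rm ran}(A_n,F_d)$, where the infimum is over all randomized algorithms that use at most $n$ function values. *)

theory Defs
  imports "HOL-Probability.Probability"
begin

section \<open>The spaces \<open>L\<^sub>\<infinity>\<close> and \<open>W\<^sup>r\<^sub>\<infinity>[0,1]\<close>\<close>

text \<open>
  Functions on a set \<open>S\<close> are represented by functions on the whole type; the values outside
  of \<open>S\<close> never matter. Elements of \<open>L\<^sub>\<infinity>\<close> are represented by functions rather than by classes.
\<close>

definition Linf_norm :: "'a::euclidean_space set \<Rightarrow> ('a \<Rightarrow> real) \<Rightarrow> ennreal" where
  "Linf_norm S f = esssup (lebesgue_on S) (\<lambda>x. ennreal \<bar>f x\<bar>)"

definition Linf :: "'a::euclidean_space set \<Rightarrow> ('a \<Rightarrow> real) set" where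
  "Linf S = {f. f \<in> borel_measurable (lebesgue_on S) \<and> Linf_norm S f < \<infinity>}"

text \<open>\<open>C\<^sub>c\<^sup>\<infinity>(0,1)\<close>, its elements being extended by zero to the real line.\<close>

definition test_functions :: "(real \<Rightarrow> real) set" where
  "test_functions =
     {\<phi>. (\<forall>k. (deriv ^^ k) \<phi> differentiable_on UNIV) \<and>
         compact (closure {x. \<phi> x \<noteq> 0}) \<and> closure {x. \<phi> x \<noteq> 0} \<subseteq> {0<..<1}}"

text \<open>
  \<open>h\<close> is the \<open>k\<close>th weak derivative of \<open>g\<close> on \<open>[0,1]\<close>, and it belongs to \<open>L\<^sub>\<infinity>\<close>. This is only
  meaningful for integrable \<open>g\<close>; below, \<open>g\<close> is continuous on \<open>[0,1]\<close>. The function \<open>h\<close> is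
  determined by \<open>g\<close> up to a null set, so its norm depends on \<open>g\<close> and \<open>k\<close> only.
\<close>

definition has_weak_deriv :: "(real \<Rightarrow> real) \<Rightarrow> nat \<Rightarrow> (real \<Rightarrow> real) \<Rightarrow> bool" where
  "has_weak_deriv g k h \<longleftrightarrow>
     h \<in> Linf {0..1} \<and>
     (\<forall>\<phi>\<in>test_functions.
        (LINT x|lebesgue_on {0..1}. g x * (deriv ^^ k) \<phi> x) =
        (-1) ^ k * (LINT x|lebesgue_on {0..1}. h x * \<phi> x))"

definition W_inf :: "nat \<Rightarrow> (real \<Rightarrow> real) set" where
  "W_inf r = {g. continuous_on {0..1} g \<and> (\<forall>k\<in>{1..r}. \<exists>h. has_weak_deriv g k h)}"

section \<open>The class of rank one functions\<close>

abbreviation unit_cube :: "(real ^ 'd::finite) set" where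
  "unit_cube \<equiv> {x. \<forall>i. x $ i \<in> {0..1}}"

definition rank_one_class :: "nat \<Rightarrow> real \<Rightarrow> (real ^ 'd::finite \<Rightarrow> real) set" where
  "rank_one_class r M =
     {f. \<exists>g :: 'd \<Rightarrow> real \<Rightarrow> real.
        (\<forall>i. g i \<in> W_inf r \<and> Linf_norm {0..1} (g i) \<le> 1 \<and>
             (\<exists>h. has_weak_deriv (g i) r h \<and> Linf_norm {0..1} h \<le> ennreal M)) \<and>
        (\<forall>x\<in>unit_cube. f x = (\<Prod>i\<in>UNIV. g i (x $ i)))}"

section \<open>Algorithms and errors\<close>

text \<open>
  \<open>node\<close> maps the list of the function values known so far to the next sampling point; the
  length of the list tells which point it is, and \<open>node []\<close> is the first one.
\<close>

primrec samples :: "(real list \<Rightarrow> 'a) \<Rightarrow> ('a \<Rightarrow> real) \<Rightarrow> nat \<Rightarrow> real list" where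
  "samples node f 0 = []"
| "samples node f (Suc k) = samples node f k @ [f (node (samples node f k))]"

text \<open>Points may be repeated or ignored, so exactly \<open>n\<close> points amount to at most \<open>n\<close> of them.\<close>

definition det_algorithm ::
  "nat \<Rightarrow> ((real ^ 'd::finite \<Rightarrow> real) \<Rightarrow> (real ^ 'd \<Rightarrow> real)) \<Rightarrow> bool" where
  "det_algorithm n A \<longleftrightarrow>
     (\<exists>node \<phi>. (\<forall>ys. length ys < n \<longrightarrow> node ys \<in> unit_cube) \<and>
               (\<forall>ys. length ys = n \<longrightarrow> \<phi> ys \<in> Linf unit_cube) \<and>
               (\<forall>f. A f = \<phi> (samples node f n)))"

text \<open>The error is required to be a random variable for every input from the class \<open>F\<close>.\<close>

definition ran_algorithm ::
  "'w measure \<Rightarrow> nat \<Rightarrow> (real ^ 'd::finite \<Rightarrow> real) set \<Rightarrow>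
   ('w \<Rightarrow> (real ^ 'd \<Rightarrow> real) \<Rightarrow> (real ^ 'd \<Rightarrow> real)) \<Rightarrow> bool" where
  "ran_algorithm P n F A \<longleftrightarrow>
     prob_space P \<and>
     (\<forall>\<omega>\<in>space P. det_algorithm n (A \<omega>)) \<and>
     (\<forall>f\<in>F. (\<lambda>\<omega>. Linf_norm unit_cube (\<lambda>x. f x - A \<omega> f x)) \<in> borel_measurable P)"

definition ennreal_sqrt :: "ennreal \<Rightarrow> ennreal" where
  "ennreal_sqrt x = (if x = \<infinity> then \<infinity> else ennreal (sqrt (enn2real x)))"

definition ran_error ::
  "'w measure \<Rightarrow> ('w \<Rightarrow> (real ^ 'd::finite \<Rightarrow> real) \<Rightarrow> (real ^ 'd \<Rightarrow> real)) \<Rightarrow>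
   (real ^ 'd \<Rightarrow> real) set \<Rightarrow> ennreal" where
  "ran_error P A F =
     (SUP f\<in>F. ennreal_sqrt (\<integral>\<^sup>+\<omega>. (Linf_norm unit_cube (\<lambda>x. f x - A \<omega> f x))\<^sup>2 \<partial>P))"

text \<open>
  The infimum over all randomized algorithms whose probability space has elementary events of
  type \<open>'w\<close>. A lower bound for every type \<open>'w\<close> is a lower bound for all randomized algorithms.
\<close>

definition min_ran_error ::
  "'w itself \<Rightarrow> nat \<Rightarrow> (real ^ 'd::finite \<Rightarrow> real) set \<Rightarrow> ennreal" where
  "min_ran_error _ n F =
     (INF (P, A)\<in>{(P :: 'w measure, A). ran_algorithm P n F A}. ran_error P A F)"

end

theory Submission
  imports Defs
begin

text \<open>
  The fooling functions are \<open>\<epsilon> \<cdot> f\<^sub>\<sigma>\<close> with a sign \<open>\<epsilon>\<close> and \<open>f\<^sub>\<sigma>\<close> a product of the one-sided powers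
  \<open>\<bar>2 x - 1\<bar> ^ r\<close> on one half of \<open>[0,1]\<close>, the halves being selected by \<open>\<sigma>\<close>. The \<open>2 ^ d\<close> functions
  \<open>f\<^sub>\<sigma>\<close> have norm one and vanish outside disjoint subcubes, so a deterministic algorithm which sees
  only zeros at its \<open>n \<le> 2 ^ (d - 1)\<close> points gives the same output for \<open>f\<^sub>\<sigma>\<close> and \<open>- f\<^sub>\<sigma>\<close>, for at least half of all
  \<open>\<sigma>\<close>. For these \<open>\<sigma>\<close> the two squared errors add up to at least \<open>2\<close>. Hence the mean squared error over
  all signs and all \<open>\<sigma>\<close> is at least \<open>1 / 2\<close>, and averaging over the random element preserves this bound.
\<close>

section \<open>Weak derivatives of piecewise differentiable functions\<close>

lemma Linf_norm_le:
  assumes "f \<in> borel_measurable (lebesgue_on S)" "S \<in> sets lebesgue" "\<And>x. x \<in> S \<Longrightarrow> \<bar>f x\<bar> \<le> B"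
  shows "Linf_norm S f \<le> ennreal B"
  unfolding Linf_norm_def
  using assms by (intro esssup_I AE_I2) (auto simp: space_restrict_space intro!: ennreal_leI)

lemma Linf_boundedI:
  assumes "f \<in> borel_measurable (lebesgue_on S)" "S \<in> sets lebesgue" "\<And>x. x \<in> S \<Longrightarrow> \<bar>f x\<bar> \<le> B"
  shows "f \<in> Linf S"
  unfolding Linf_def using assms Linf_norm_le[OF assms]
  by (auto intro: le_less_trans)

lemma integrable_lebesgue_on_bounded:
  fixes f :: "'a::euclidean_space \<Rightarrow> real"
  assumes "f \<in> borel_measurable (lebesgue_on S)" "S \<in> lmeasurable" "\<And>x. x \<in> S \<Longrightarrow> \<bar>f x\<bar> \<le> B"
  shows "integrable (lebesgue_on S) f"
proof -
  interpret finite_measure "lebesgue_on S"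
    using assms(2) by (rule finite_measure_lebesgue_on)
  show ?thesis
    using assms by (intro integrable_const_bound[where B = B] AE_I2) (auto simp: space_restrict_space)
qed

lemma continuous_on_Icc_abs_bound:
  fixes f :: "real \<Rightarrow> real"
  assumes "continuous_on {a..b} f"
  obtains B where "\<And>x. x \<in> {a..b} \<Longrightarrow> \<bar>f x\<bar> \<le> B"
proof -
  have "bounded (f ` {a..b})"
    using assms compact_continuous_image compact_imp_bounded by blast
  then obtain B where "\<forall>x\<in>{a..b}. \<bar>f x\<bar> \<le> B"
    by (auto simp: bounded_iff)
  then show ?thesis
    using that by blast
qed

section \<open>Test functions and their derivatives\<close>

lemma test_functions_continuous:
  assumes "\<phi> \<in> test_functions"
  shows "continuous_on S ((deriv ^^ k) \<phi>)"
proof -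
  have "(deriv ^^ k) \<phi> differentiable_on UNIV"
    using assms unfolding test_functions_def by blast
  then have "continuous_on UNIV ((deriv ^^ k) \<phi>)"
    by (rule differentiable_imp_continuous_on)
  then show ?thesis
    by (rule continuous_on_subset) simp
qed

lemma test_functions_has_deriv:
  assumes "\<phi> \<in> test_functions"
  shows "(\<phi> has_real_derivative deriv \<phi> x) (at x)"
proof -
  have "(deriv ^^ 0) \<phi> differentiable_on UNIV"
    using assms unfolding test_functions_def by blast
  then show ?thesis
    by (simp add: differentiable_on_def DERIV_deriv_iff_real_differentiable)
qed

lemma test_functions_ends:
  assumes "\<phi> \<in> test_functions"
  shows "\<phi> 0 = 0" "\<phi> 1 = 0"
proof -
  have "{x. \<phi> x \<noteq> 0} \<subseteq> {0<..<1}"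
    using assms closure_subset[of "{x. \<phi> x \<noteq> 0}"] unfolding test_functions_def by blast
  then show "\<phi> 0 = 0" "\<phi> 1 = 0" by force+
qed

text \<open>Outside the closed support, \<open>\<phi>\<close> vanishes on a whole neighbourhood, so
  its derivative vanishes there too and the support cannot grow.\<close>

lemma test_functions_deriv:
  assumes "\<phi> \<in> test_functions"
  shows "deriv \<phi> \<in> test_functions"
proof -
  let ?S = "closure {x. \<phi> x \<noteq> 0}"
  have "deriv \<phi> x = 0" if "x \<notin> ?S" for x
  proof -
    have "eventually (\<lambda>y. y \<in> - ?S) (nhds x)"
      using that by (intro eventually_nhds_in_open) auto
    then have "eventually (\<lambda>y. \<phi> y = 0) (nhds x)"
      by eventually_elim (use closure_subset[of "{x. \<phi> x \<noteq> 0}"] in auto)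
    then have "deriv \<phi> x = deriv (\<lambda>_. 0) x"
      by (rule deriv_cong_ev) simp
    then show ?thesis by simp
  qed
  then have "closure {x. deriv \<phi> x \<noteq> 0} \<subseteq> ?S"
    by (intro closure_minimal) auto
  moreover from this have "compact (closure {x. deriv \<phi> x \<noteq> 0})"
    using assms bounded_subset[of ?S] by (auto simp: test_functions_def compact_eq_bounded_closed)
  moreover have "(deriv ^^ k) (deriv \<phi>) differentiable_on UNIV" for k
  proof -
    have "(deriv ^^ Suc k) \<phi> differentiable_on UNIV"
      using assms unfolding test_functions_def by blast
    then show ?thesis by (simp add: funpow_Suc_right del: funpow.simps)
  qed
  ultimately show ?thesis
    using assms unfolding test_functions_def by blast
qed

section \<open>Weak derivatives raised one order at a time\<close>

lemma has_weak_deriv_0: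
  assumes "continuous_on {0..1} g"
  shows "has_weak_deriv g 0 g"
proof -
  obtain B where "\<And>x. x \<in> {0..1} \<Longrightarrow> \<bar>g x\<bar> \<le> B"
    using continuous_on_Icc_abs_bound[OF assms] by blast
  then have "g \<in> Linf {0..1}"
    using assms by (intro Linf_boundedI[where B = B] continuous_imp_measurable_on_sets_lebesgue) auto
  then show ?thesis
    by (simp add: has_weak_deriv_def)
qed

text \<open>Test the \<open>k\<close>th weak derivative against \<open>deriv \<phi>\<close>, then
  integrate by parts once. Since \<open>h\<close> is continuous, a finite exceptional set does no
  harm; thus \<open>h'\<close> may have jumps, as the top derivative of a fooling factor
  does.\<close>

lemma has_weak_deriv_Suc:
  assumes g: "has_weak_deriv g k h" and h: "continuous_on {0..1} h"
    and "finite N" and deriv: "\<And>x. x \<in> {0<..<1} - N \<Longrightarrow> (h has_real_derivative h' x) (at x)"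
    and h': "h' \<in> borel_measurable (lebesgue_on {0..1})" "\<And>x. x \<in> {0..1} \<Longrightarrow> \<bar>h' x\<bar> \<le> B"
  shows "has_weak_deriv g (Suc k) h'"
  unfolding has_weak_deriv_def
proof (intro conjI ballI)
  show "h' \<in> Linf {0..1}"
    using h' by (intro Linf_boundedI) auto
  fix \<phi> assume \<phi>: "\<phi> \<in> test_functions"
  have cont: "continuous_on {0..1} \<phi>" "continuous_on {0..1} (deriv \<phi>)"
    using test_functions_continuous[OF \<phi>, of _ 0] test_functions_continuous[OF \<phi>, of _ 1] by simp_all
  obtain C where C: "\<And>x. x \<in> {0..1} \<Longrightarrow> \<bar>\<phi> x\<bar> \<le> C"
    using continuous_on_Icc_abs_bound[OF cont(1)] by blast
  obtain D where D: "\<And>x. x \<in> {0..1} \<Longrightarrow> \<bar>h x * deriv \<phi> x\<bar> \<le> D"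
    using continuous_on_Icc_abs_bound[OF continuous_on_mult[OF h cont(2)]] by blast
  have int1: "integrable (lebesgue_on {0..1}) (\<lambda>x. h x * deriv \<phi> x)"
    using D h cont by (intro integrable_lebesgue_on_bounded[where B = D]
        continuous_imp_measurable_on_sets_lebesgue continuous_intros) auto
  have "\<phi> \<in> borel_measurable (lebesgue_on {0..1})"
    using cont by (intro continuous_imp_measurable_on_sets_lebesgue) auto
  moreover have "\<bar>h' x * \<phi> x\<bar> \<le> B * C" if "x \<in> {0..1}" for x
    using h'(2)[OF that] C[OF that] by (auto simp: abs_mult intro!: mult_mono)
  ultimately have int2: "integrable (lebesgue_on {0..1}) (\<lambda>x. h' x * \<phi> x)"
    using h'(1) by (intro integrable_lebesgue_on_bounded[where B = "B * C"]) auto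
  \<comment> \<open>The value is chosen so that the boundary terms, which are zero because
    \<open>\<phi>\<close> vanishes at 0 and 1, leave exactly the integral of
    \<open>h * deriv \<phi>\<close>. Integrability (\<open>int1\<close>, \<open>int2\<close>) then
    turns this gauge integral identity into a Lebesgue one.\<close>
  have "((\<lambda>x. h' x * \<phi> x) has_integral - integral {0..1} (\<lambda>x. h x * deriv \<phi> x)) {0..1}"
  proof (rule integration_by_parts_interior_strong[OF bounded_bilinear_mult \<open>finite N\<close>, where f = h and g' = "deriv \<phi>"])
    show "((\<lambda>x. h x * deriv \<phi> x) has_integral
        h 1 * \<phi> 1 - h 0 * \<phi> 0 - - integral {0..1} (\<lambda>x. h x * deriv \<phi> x)) {0..1}"
      using h cont by (auto simp: test_functions_ends[OF \<phi>] intro!: integrable_integral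
          integrable_continuous_interval continuous_intros)
  qed (use deriv h cont test_functions_has_deriv[OF \<phi>] in
      \<open>auto simp: has_real_derivative_iff_has_vector_derivative\<close>)
  then have "(LINT x|lebesgue_on {0..1}. h' x * \<phi> x) = - (LINT x|lebesgue_on {0..1}. h x * deriv \<phi> x)"
    using int1 int2 by (simp add: lebesgue_integral_eq_integral integral_unique)
  moreover have "(LINT x|lebesgue_on {0..1}. g x * (deriv ^^ k) (deriv \<phi>) x)
      = (- 1) ^ k * (LINT x|lebesgue_on {0..1}. h x * deriv \<phi> x)"
    using g test_functions_deriv[OF \<phi>] by (simp add: has_weak_deriv_def)
  ultimately show "(LINT x|lebesgue_on {0..1}. g x * (deriv ^^ Suc k) \<phi> x)
      = (- 1) ^ Suc k * (LINT x|lebesgue_on {0..1}. h' x * \<phi> x)"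
    by (simp add: funpow_Suc_right del: funpow.simps)
qed

section \<open>The fooling functions\<close>

text \<open>The value \<open>max 0 t ^ j\<close> would be wrong for \<open>j = 0\<close>, since \<open>0 ^ 0 = 1\<close>; this case is the \<open>r\<close>th derivative.\<close>

definition half_coord :: "bool \<Rightarrow> real \<Rightarrow> real" where
  "half_coord b x = (if b then 2 * x - 1 else 1 - 2 * x)"

definition half_power :: "bool \<Rightarrow> nat \<Rightarrow> real \<Rightarrow> real" where
  "half_power b j x = (if 0 < half_coord b x then half_coord b x ^ j else 0)"

lemma half_power_Suc: "half_power b (Suc j) x = max 0 (half_coord b x) ^ Suc j"
  by (simp add: half_power_def max_def)

lemma continuous_on_half_power:
  assumes "j > 0"
  shows "continuous_on S (half_power b j)"
proof -
  have "continuous_on S (\<lambda>x. max 0 (half_coord b x) ^ j)"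
    by (cases b) (auto simp: half_coord_def intro!: continuous_intros)
  then show ?thesis
    using assms by (cases j) (simp_all add: half_power_Suc[abs_def])
qed

lemma half_power_measurable [measurable]: "half_power b j \<in> borel_measurable borel"
  unfolding half_power_def half_coord_def by measurable

lemma half_power_abs_le_1: "x \<in> {0..1} \<Longrightarrow> \<bar>half_power b j x\<bar> \<le> 1"
  by (auto simp: half_power_def half_coord_def intro!: power_le_one)

text \<open>Away from the kink at 1/2 the function agrees locally with a power of an affine function
  or with zero.\<close>

lemma half_power_has_deriv:
  assumes "x \<noteq> 1 / 2"
  shows "(half_power b (Suc j) has_real_derivative
           (if b then 2 else - 2) * real (Suc j) * half_power b j x) (at x)"
proof -
  have lin: "(half_coord b has_real_derivative (if b then 2 else - 2)) (at x)"
    unfolding half_coord_def by (cases b) (auto intro!: derivative_eq_intros)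
  have cont: "isCont (half_coord b) x"
    using lin by (rule DERIV_isCont)
  consider "half_coord b x > 0" | "half_coord b x < 0"
    using assms by (cases b; cases "x < 1 / 2") (auto simp: half_coord_def)
  then show ?thesis
  proof cases
    case 1
    have "((\<lambda>y. half_coord b y ^ Suc j) has_real_derivative
        (if b then 2 else - 2) * real (Suc j) * half_power b j x) (at x)"
      by (rule DERIV_cong[OF DERIV_power_Suc[OF lin]]) (use 1 in \<open>simp add: half_power_def\<close>)
    moreover have "eventually (\<lambda>y. half_coord b y > 0) (nhds x)"
      using cont 1 by (auto simp: isCont_def tendsto_at_iff_tendsto_nhds intro: order_tendstoD)
    then have "eventually (\<lambda>y. half_power b (Suc j) y = half_coord b y ^ Suc j) (nhds x)"
      by eventually_elim (simp add: half_power_def)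
    ultimately show ?thesis
      by (subst DERIV_cong_ev[OF refl _ refl]) auto
  next
    case 2
    have "eventually (\<lambda>y. half_coord b y < 0) (nhds x)"
      using cont 2 by (auto simp: isCont_def tendsto_at_iff_tendsto_nhds intro: order_tendstoD)
    then have "eventually (\<lambda>y. half_power b (Suc j) y = 0) (nhds x)"
      by eventually_elim (simp add: half_power_def)
    then show ?thesis
      using 2 by (subst DERIV_cong_ev[OF refl _ refl, where g = "\<lambda>_. 0"]) (auto simp: half_power_def)
  qed
qed

text \<open>Induction on \<open>k\<close>: for \<open>k < r\<close> the exponent
  \<open>r - k\<close> is positive, so the current derivative is continuous and can be
  differentiated once more. Only the last one, at \<open>k = r\<close>, may jump at 1/2.\<close>

lemma half_power_weak_deriv:
  assumes "k \<le> r" "r > 0"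
  shows "has_weak_deriv (\<lambda>x. c * half_power b r x) k
     (\<lambda>x. c * (if b then 2 else - 2) ^ k * (fact r / fact (r - k)) * half_power b (r - k) x)"
  using \<open>k \<le> r\<close>
proof (induction k)
  case 0
  then show ?case
    using \<open>r > 0\<close> by (auto intro!: has_weak_deriv_0 continuous_intros continuous_on_half_power)
next
  case (Suc k)
  define j where "j = r - Suc k"
  have j: "r - k = Suc j"
    using Suc.prems by (simp add: j_def)
  let ?a = "\<lambda>k. c * (if b then 2 else - 2) ^ k * (fact r / fact (r - k)) :: real"
  show ?case
  proof (rule has_weak_deriv_Suc[where N = "{1 / 2}" and B = "\<bar>?a (Suc k)\<bar>"])
    show "has_weak_deriv (\<lambda>x. c * half_power b r x) k (\<lambda>x. ?a k * half_power b (r - k) x)"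
      using Suc by simp
    show "continuous_on {0..1} (\<lambda>x. ?a k * half_power b (r - k) x)"
      using Suc.prems by (intro continuous_intros continuous_on_half_power) auto
    show "((\<lambda>x. ?a k * half_power b (r - k) x) has_real_derivative
        ?a (Suc k) * half_power b (r - Suc k) x) (at x)" if "x \<in> {0<..<1} - {1 / 2}" for x
    proof (rule DERIV_cong)
      show "((\<lambda>x. ?a k * half_power b (r - k) x) has_real_derivative
          ?a k * ((if b then 2 else - 2) * real (Suc j) * half_power b j x)) (at x)"
        unfolding j using that by (intro DERIV_cmult half_power_has_deriv) auto
    qed (simp add: j j_def[symmetric] divide_simps)
    show "(\<lambda>x. ?a (Suc k) * half_power b (r - Suc k) x) \<in> borel_measurable (lebesgue_on {0..1})"
      by (intro measurable_restrict_space1 measurable_completion) measurable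
    show "\<bar>?a (Suc k) * half_power b (r - Suc k) x\<bar> \<le> \<bar>?a (Suc k)\<bar>" if "x \<in> {0..1}" for x
      using mult_left_mono[OF half_power_abs_le_1[OF that], of "\<bar>?a (Suc k)\<bar>"]
      by (simp add: abs_mult)
  qed auto
qed

section \<open>Products of half powers\<close>

definition fooling :: "nat \<Rightarrow> real \<Rightarrow> ('d \<Rightarrow> bool) \<Rightarrow> real ^ 'd::finite \<Rightarrow> real" where
  "fooling r \<epsilon> \<sigma> x = \<epsilon> * (\<Prod>i\<in>UNIV. half_power (\<sigma> i) r (x $ i))"

text \<open>The scalar \<open>\<epsilon>\<close> is absorbed into a single factor, so that every
  factor keeps norm at most one.\<close>

lemma fooling_in_rank_one_class:
  assumes "r > 0" "M \<ge> 2 ^ r * fact r" "\<bar>\<epsilon>\<bar> \<le> 1"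
  shows "(fooling r \<epsilon> \<sigma> :: real ^ 'd::finite \<Rightarrow> real) \<in> rank_one_class r M"
proof -
  obtain i0 :: 'd where True by simp
  define c where "c i = (if i = i0 then \<epsilon> else 1)" for i
  define g where "g i x = c i * half_power (\<sigma> i) r x" for i x
  have c: "\<bar>c i\<bar> \<le> 1" for i
    using assms(3) by (simp add: c_def)
  have g: "has_weak_deriv (g i) k
      (\<lambda>x. c i * (if \<sigma> i then 2 else - 2) ^ k * (fact r / fact (r - k)) * half_power (\<sigma> i) (r - k) x)"
    if "k \<le> r" for i k
    unfolding g_def using that assms(1) by (rule half_power_weak_deriv)
  have bound: "\<bar>c i * half_power (\<sigma> i) j x\<bar> \<le> 1" if "x \<in> {0..1}" for i j x
    using mult_mono[OF c half_power_abs_le_1[OF that]] by (simp add: abs_mult)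
  have "g i \<in> W_inf r" for i
  proof -
    have "continuous_on {0..1} (g i)"
      unfolding g_def using assms(1) by (intro continuous_intros continuous_on_half_power)
    then show ?thesis
      using g unfolding W_inf_def by fastforce
  qed
  moreover have "Linf_norm {0..1} (g i) \<le> 1" for i
  proof -
    have "Linf_norm {0..1} (g i) \<le> ennreal 1"
      unfolding g_def by (intro Linf_norm_le bound measurable_restrict_space1 measurable_completion) auto
    then show ?thesis by simp
  qed
  moreover have "\<exists>h. has_weak_deriv (g i) r h \<and> Linf_norm {0..1} h \<le> ennreal M" for i
  proof -
    let ?h = "\<lambda>x. c i * (if \<sigma> i then 2 else - 2) ^ r * (fact r / fact (r - r)) * half_power (\<sigma> i) (r - r) x"
    have "\<bar>?h x\<bar> \<le> M" if "x \<in> {0..1}" for x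
    proof -
      \<comment> \<open>The \<open>r\<close>th derivative is a step function of height at most
        \<open>2 ^ r * fact r\<close>, which is where the lower bound on \<open>M\<close> comes
        from.\<close>
      have "\<bar>?h x\<bar> = 2 ^ r * fact r * \<bar>c i * half_power (\<sigma> i) 0 x\<bar>"
        by (simp add: abs_mult power_abs)
      also have "\<dots> \<le> 2 ^ r * fact r * 1"
        by (intro mult_left_mono bound[OF that]) simp
      finally show ?thesis using assms(2) by simp
    qed
    then have "Linf_norm {0..1} ?h \<le> ennreal M"
      by (intro Linf_norm_le measurable_restrict_space1 measurable_completion) auto
    then show ?thesis
      using g[of r i] by blast
  qed
  moreover have "fooling r \<epsilon> \<sigma> x = (\<Prod>i\<in>UNIV. g i (x $ i))" for x
    by (simp add: fooling_def g_def prod.distrib c_def)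
  ultimately show ?thesis
    unfolding rank_one_class_def by blast
qed

lemma continuous_on_fooling:
  assumes "r > 0"
  shows "continuous_on S (fooling r \<epsilon> \<sigma>)"
  unfolding fooling_def
  by (intro continuous_intros continuous_on_compose2[OF continuous_on_half_power[OF assms, of UNIV]]) auto

lemma fooling_corner: "fooling r \<epsilon> \<sigma> (\<chi> i. of_bool (\<sigma> i)) = \<epsilon>"
proof -
  have "half_power (\<sigma> i) r (of_bool (\<sigma> i)) = 1" for i
    by (simp add: half_power_def half_coord_def)
  then show ?thesis
    by (simp add: fooling_def)
qed

text \<open>This is the disjointness of the supports: one sampling point can detect at most one
  \<open>\<sigma>\<close>.\<close>

lemma fooling_nonzero_imp:
  assumes "fooling r \<epsilon> \<sigma> x \<noteq> 0"
  shows "\<sigma> = (\<lambda>i. x $ i > 1 / 2)"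
proof
  fix i
  have "half_power (\<sigma> i) r (x $ i) \<noteq> 0"
    using assms by (auto simp: fooling_def)
  then show "\<sigma> i = (x $ i > 1 / 2)"
    by (auto simp: half_power_def half_coord_def split: if_splits)
qed

lemma fooling_minus: "fooling r (- \<epsilon>) \<sigma> x = - fooling r \<epsilon> \<sigma> x"
  by (simp add: fooling_def)

section \<open>Errors of an algorithm on a pair of opposite functions\<close>

lemma unit_cube_eq_cbox: "unit_cube = cbox (0 :: real ^ 'd::finite) 1"
  by (auto simp: mem_box_cart)

text \<open>The triangle inequality gives the bound almost everywhere. Continuity of
  \<open>f\<close> makes the set where it holds closed, so it contains the open cube and then its
  closure. Boundary points matter because the peaks of the fooling functions are at corners.\<close>

lemma Linf_norm_triangle_ge_pointwise:
  fixes f :: "real ^ 'd::finite \<Rightarrow> real"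
  assumes f: "continuous_on UNIV f" and x: "x \<in> unit_cube"
  shows "ennreal (2 * \<bar>f x\<bar>) \<le> Linf_norm unit_cube (\<lambda>x. f x - a x) + Linf_norm unit_cube (\<lambda>x. - f x - a x)"
    (is "_ \<le> ?E1 + ?E2")
proof (cases "?E1 + ?E2 = \<infinity>")
  case False
  define z where "z = enn2real (?E1 + ?E2)"
  have z: "?E1 + ?E2 = ennreal z" "0 \<le> z"
    using False by (simp_all add: z_def top.not_eq_extremum del: ennreal_add_eq_top)
  have "AE x in lebesgue_on unit_cube. ennreal \<bar>f x - a x\<bar> \<le> ?E1"
    "AE x in lebesgue_on unit_cube. ennreal \<bar>- f x - a x\<bar> \<le> ?E2"
    unfolding Linf_norm_def by (rule esssup_AE)+
  then have "AE x in lebesgue_on unit_cube. 2 * \<bar>f x\<bar> \<le> z"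
  proof eventually_elim
    case (elim x)
    have "ennreal (\<bar>f x - a x\<bar> + \<bar>- f x - a x\<bar>) \<le> ennreal z"
      using add_mono[OF elim] z by (simp add: ennreal_plus)
    then have "\<bar>f x - a x\<bar> + \<bar>- f x - a x\<bar> \<le> z"
      using z by (subst (asm) ennreal_le_iff) auto
    then show ?case by linarith
  qed
  then have "AE x in lebesgue. x \<in> cbox 0 1 \<longrightarrow> 2 * \<bar>f x\<bar> \<le> z"
    unfolding unit_cube_eq_cbox by (subst (asm) AE_restrict_space_iff) auto
  then have ae: "AE x in lebesgue. x \<in> box 0 1 \<longrightarrow> x \<in> {x. 2 * \<bar>f x\<bar> \<le> z}"
    by eventually_elim (use box_subset_cbox[of 0 1] in auto)
  have closed: "closed {x. 2 * \<bar>f x\<bar> \<le> z}"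
    using f by (intro closed_Collect_le continuous_intros)
  have "box 0 1 \<subseteq> {x. 2 * \<bar>f x\<bar> \<le> z}"
    using mem_closed_if_AE_lebesgue_open[OF open_box closed ae] by blast
  then have "closure (box 0 1) \<subseteq> {x. 2 * \<bar>f x\<bar> \<le> z}"
    using closed by (rule closure_minimal)
  moreover have "box (0 :: real ^ 'd) 1 \<noteq> {}"
    by (auto simp: interval_eq_empty_cart)
  ultimately have "2 * \<bar>f x\<bar> \<le> z"
    using x unfolding unit_cube_eq_cbox by auto
  then show ?thesis
    using z by (simp add: ennreal_leI)
qed auto

text \<open>In the finite case, \<open>2 * (x\<^sup>2 + y\<^sup>2) = (x + y)\<^sup>2 + (x -
  y)\<^sup>2\<close> is at least 4.\<close>

lemma ennreal_sum_squares_ge_2: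
  fixes a b :: ennreal
  assumes "2 \<le> a + b"
  shows "2 \<le> a\<^sup>2 + b\<^sup>2"
proof (cases a; cases b)
  fix x y :: real
  assume xy: "a = ennreal x" "b = ennreal y" "0 \<le> x" "0 \<le> y"
  have "ennreal 2 \<le> ennreal (x + y)"
    using assms xy by (simp add: ennreal_plus)
  then have "2 \<le> x + y"
    using xy by (subst (asm) ennreal_le_iff) auto
  then have "2 * 2 \<le> (x + y) * (x + y)"
    by (intro mult_mono) auto
  moreover have "0 \<le> (x - y)\<^sup>2" by simp
  ultimately have "2 \<le> x\<^sup>2 + y\<^sup>2"
    by (simp add: power2_eq_square algebra_simps)
  then have "ennreal 2 \<le> ennreal (x\<^sup>2 + y\<^sup>2)"
    by (rule ennreal_leI)
  then show ?thesis
    using xy by (simp add: ennreal_plus ennreal_power)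
qed (auto simp: top_power_ennreal)

section \<open>Counting the fooling functions missed by a deterministic algorithm\<close>

lemma samples_eq_samples_zero:
  assumes "\<And>k. k < n \<Longrightarrow> f (node (samples node (\<lambda>_. 0) k)) = 0"
  shows "samples node f n = samples node (\<lambda>_. 0) n"
  using assms by (induction n) auto

text \<open>At most half of the \<open>2 ^ CARD('d)\<close> patterns \<open>\<sigma>\<close> are
  detected, and each of the others contributes at least 2.\<close>

lemma det_algorithm_mean_error:
  fixes A :: "(real ^ 'd::finite \<Rightarrow> real) \<Rightarrow> (real ^ 'd \<Rightarrow> real)"
  assumes A: "det_algorithm n A" and r: "r > 0" and n: "n \<le> 2 ^ (CARD('d) - 1)"
  shows "2 ^ CARD('d) \<le> (\<Sum>\<sigma>\<in>UNIV.
      (Linf_norm unit_cube (\<lambda>x. fooling r 1 \<sigma> x - A (fooling r 1 \<sigma>) x))\<^sup>2 +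
      (Linf_norm unit_cube (\<lambda>x. fooling r (- 1) \<sigma> x - A (fooling r (- 1) \<sigma>) x))\<^sup>2)"
    (is "_ \<le> sum ?e UNIV")
proof -
  obtain node \<phi> where A: "\<And>f. A f = \<phi> (samples node f n)"
    using A unfolding det_algorithm_def by blast
  \<comment> \<open>Adaptive nodes depend on the input, so the nodes of the run on the zero function
    are used. An input that vanishes at all of them produces the same run, hence the same output for
    both signs.\<close>
  define seen where "seen = (\<lambda>k i. node (samples node (\<lambda>_. 0) k) $ i > 1 / 2) ` {..<n}"
  have card_seen: "card seen \<le> n"
    unfolding seen_def by (rule order.trans[OF card_image_le]) auto
  have "2 \<le> ?e \<sigma>" if "\<sigma> \<notin> seen" for \<sigma>
  proof -
    have "fooling r \<epsilon> \<sigma> (node (samples node (\<lambda>_. 0) k)) = 0" if "k < n" for \<epsilon> k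
      using fooling_nonzero_imp \<open>\<sigma> \<notin> seen\<close> that unfolding seen_def by blast
    then have same: "A (fooling r \<epsilon> \<sigma>) = \<phi> (samples node (\<lambda>_. 0) n)" for \<epsilon>
      unfolding A by (subst samples_eq_samples_zero) auto
    have "2 \<le> Linf_norm unit_cube (\<lambda>x. fooling r 1 \<sigma> x - A (fooling r 1 \<sigma>) x) +
        Linf_norm unit_cube (\<lambda>x. fooling r (- 1) \<sigma> x - A (fooling r (- 1) \<sigma>) x)"
      using Linf_norm_triangle_ge_pointwise[OF continuous_on_fooling[OF r], of "\<chi> i. of_bool (\<sigma> i)" 1 \<sigma>]
      unfolding same fooling_minus fooling_corner by auto
    then show ?thesis by (rule ennreal_sum_squares_ge_2)
  qed
  then have "(\<Sum>\<sigma>\<in>- seen. 2) \<le> sum ?e (- seen)"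
    by (intro sum_mono) auto
  also have "\<dots> \<le> sum ?e UNIV"
    by (intro sum_mono2) auto
  finally have le: "of_nat (2 * card (- seen)) \<le> sum ?e UNIV"
    by (simp add: mult.commute)
  have "CARD('d \<Rightarrow> bool) = 2 ^ CARD('d)"
    by (simp add: card_fun)
  moreover have "(2::nat) ^ CARD('d) = 2 * 2 ^ (CARD('d) - 1)"
    by (metis power_eq_if zero_less_card_finite less_irrefl)
  ultimately have "2 ^ CARD('d) \<le> 2 * card (- seen)"
    using card_seen n by (simp add: Compl_eq_Diff_UNIV card_Diff_subset)
  then have "of_nat (2 ^ CARD('d)) \<le> (of_nat (2 * card (- seen)) :: ennreal)"
    by (rule of_nat_mono)
  with le show ?thesis
    by (simp del: of_nat_mult)
qed

section \<open>Averaging over the random element\<close>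

lemma le_power2_if_ennreal_sqrt_le:
  assumes "ennreal_sqrt x \<le> s"
  shows "x \<le> s\<^sup>2"
proof (cases s; cases x)
  fix u v :: real
  assume uv: "s = ennreal u" "x = ennreal v" "0 \<le> u" "0 \<le> v"
  then have "sqrt v \<le> u"
    using assms by (simp add: ennreal_sqrt_def)
  then have "v \<le> u\<^sup>2"
    using uv by (simp add: sqrt_le_D)
  then show ?thesis
    using uv by (simp add: ennreal_power ennreal_leI)
qed (use assms in \<open>auto simp: ennreal_sqrt_def top_power_ennreal top_unique\<close>)

text \<open>Integrating the deterministic bound over \<open>\<omega>\<close> bounds the sum of
  \<open>2 * 2 ^ CARD('d)\<close> mean squared errors from below by \<open>2 ^ CARD('d)\<close>.
  Each of them is at most the square of the worst case error, so that square is at least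
  1/2.\<close>

lemma ran_error_ge:
  fixes A :: "'w \<Rightarrow> (real ^ 'd::finite \<Rightarrow> real) \<Rightarrow> (real ^ 'd \<Rightarrow> real)"
  assumes A: "ran_algorithm P n (rank_one_class r M) A"
    and r: "r > 0" and M: "M \<ge> 2 ^ r * fact r" and n: "n \<le> 2 ^ (CARD('d) - 1)"
  shows "ennreal (1 / 2 * sqrt 2) \<le> ran_error P A (rank_one_class r M)"
    (is "_ \<le> ?s")
proof -
  interpret prob_space P
    using A by (simp add: ran_algorithm_def)
  define e where "e \<epsilon> \<sigma> \<omega> = (Linf_norm unit_cube (\<lambda>x. fooling r \<epsilon> \<sigma> x - A \<omega> (fooling r \<epsilon> \<sigma>) x))\<^sup>2"
    for \<epsilon> and \<sigma> :: "'d \<Rightarrow> bool" and \<omega>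
  have F: "fooling r \<epsilon> \<sigma> \<in> rank_one_class r M" if "\<epsilon> \<in> {1, - 1}" for \<epsilon> and \<sigma> :: "'d \<Rightarrow> bool"
    by (rule fooling_in_rank_one_class[OF r M]) (use that in auto)
  \<comment> \<open>Measurability of each error allows the integral to be exchanged with the finite
    sum.\<close>
  have e_meas: "e \<epsilon> \<sigma> \<in> borel_measurable P" if "\<epsilon> \<in> {1, - 1}" for \<epsilon> \<sigma>
  proof -
    have [measurable]: "(\<lambda>\<omega>. Linf_norm unit_cube (\<lambda>x. fooling r \<epsilon> \<sigma> x - A \<omega> (fooling r \<epsilon> \<sigma>) x))
        \<in> borel_measurable P"
      using A F[OF that] unfolding ran_algorithm_def by blast
    show ?thesis
      unfolding e_def power2_eq_square by measurable
  qed
  have e_le: "(\<integral>\<^sup>+\<omega>. e \<epsilon> \<sigma> \<omega> \<partial>P) \<le> ?s\<^sup>2" if "\<epsilon> \<in> {1, - 1}" for \<epsilon> \<sigma>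
    unfolding e_def ran_error_def
    by (intro le_power2_if_ennreal_sqrt_le SUP_upper F[OF that])
  have "2 ^ CARD('d) = (\<integral>\<^sup>+\<omega>. 2 ^ CARD('d) \<partial>P)"
    by (simp add: emeasure_space_1)
  also have "\<dots> \<le> (\<integral>\<^sup>+\<omega>. (\<Sum>\<sigma>\<in>UNIV. e 1 \<sigma> \<omega> + e (- 1) \<sigma> \<omega>) \<partial>P)"
    unfolding e_def using A r n
    by (intro nn_integral_mono det_algorithm_mean_error) (auto simp: ran_algorithm_def)
  also have "\<dots> = (\<Sum>\<sigma>\<in>UNIV. (\<integral>\<^sup>+\<omega>. e 1 \<sigma> \<omega> \<partial>P) + (\<integral>\<^sup>+\<omega>. e (- 1) \<sigma> \<omega> \<partial>P))"
    by (subst nn_integral_sum) (auto simp: nn_integral_add e_meas intro!: borel_measurable_add)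
  also have "\<dots> \<le> (\<Sum>\<sigma>\<in>(UNIV :: ('d \<Rightarrow> bool) set). ?s\<^sup>2 + ?s\<^sup>2)"
    by (intro sum_mono add_mono e_le) auto
  finally have le: "2 ^ CARD('d) \<le> 2 ^ CARD('d) * (2 * ?s\<^sup>2)"
    by (simp add: card_fun mult_2)
  show ?thesis
  proof (cases ?s)
    case (real s)
    have "ennreal (2 ^ CARD('d)) \<le> ennreal (2 ^ CARD('d) * (2 * s\<^sup>2))"
      using le real by (simp add: ennreal_mult flip: ennreal_power)
    then have "2 ^ CARD('d) * 1 \<le> 2 ^ CARD('d) * (2 * s\<^sup>2)"
      by (subst (asm) ennreal_le_iff) auto
    then have "1 / 2 \<le> s\<^sup>2"
      by (subst (asm) mult_le_cancel_left_pos) auto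
    then have "sqrt (1 / 2) \<le> s"
      using real by (intro real_le_lsqrt) auto
    moreover have "sqrt (1 / 2) = 1 / 2 * sqrt 2"
      by (simp add: real_sqrt_divide field_simps)
    ultimately show ?thesis
      using real by (auto intro: ennreal_leI)
  qed simp
qed

theorem theorem3:
  fixes r n :: nat and M :: real
  assumes "r \<ge> 1"
    and "M \<ge> 2 ^ r * fact r"
    and "1 \<le> n" and "n \<le> 2 ^ (CARD('d::finite) - 1)"
  shows "min_ran_error TYPE('w) n (rank_one_class r M :: (real ^ 'd \<Rightarrow> real) set)
           \<ge> ennreal (1 / 2 * sqrt 2)"
  unfolding min_ran_error_def
proof (intro INF_greatest, clarify)
  fix P :: "'w measure" and A :: "'w \<Rightarrow> (real ^ 'd \<Rightarrow> real) \<Rightarrow> (real ^ 'd \<Rightarrow> real)"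
  assume "ran_algorithm P n (rank_one_class r M) A"
  then show "ennreal (1 / 2 * sqrt 2) \<le> ran_error P A (rank_one_class r M)"
    using assms by (intro ran_error_ge) auto
qed

end
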